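(* Let $A\in\mathcal{M}_n(\mathbb{C})$ and $\alpha,\beta\in\mathbb{R}\setminus\{0\}$. (a) If $A$ is a normal matrix and $\partial NR[A]$ is a $k$-polygon, then $\partial NR[\mathcal{L}(A,\alpha,\beta)]$ is also a $k$-polygon. (b) $NR[\mathcal{L}(A,\alpha,\beta)]\cap\mathbb{R}=\mathbb{R}\cap NR[\alpha A]$.
   Context: $\mathcal{M}_n(\mathbb{C})$ is the algebra of $n\times n$ complex matrices. The numerical range of $A$ is $NR[A]=\{x^*Ax:\ x\in\mathbb{C}^n,\ x^*x=1\}$ and $\partial NR[A]$ is its boundary. The generalized Levinger transformation of $A$ is $\mathcal{L}(A,\alpha,\beta)=\alpha H_A+\beta S_A=\frac{\alpha+\beta}{2}A+\frac{\alpha-\beta}{2}A^*$, where $H_A=\frac{A+A^*}{2}$, $S_A=\frac{A-A^*}{2}$. For normal $A$, $NR[A]$ is the convex hull of the spectrum of $A$; a $k$-polygon is a convex polygon with $k$ vertices. *)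

theory Defs
  imports "HOL-Analysis.Analysis" "Jordan_Normal_Form.Schur_Decomposition"
begin

unbundle no vec_syntax

definition normal_matrix :: "complex mat \<Rightarrow> bool" where
  "normal_matrix A \<longleftrightarrow> square_mat A \<and> A * mat_adjoint A = mat_adjoint A * A"

text \<open>
  The operator \<open>\<bullet>c\<close> conjugates its second argument, so \<open>u \<bullet>c x\<close> is the
  row-times-column product \<open>x\<^sup>* u\<close>.
\<close>

definition numerical_range :: "complex mat \<Rightarrow> complex set" where
  "numerical_range A =
     {(A *\<^sub>v x) \<bullet>c x | x. x \<in> carrier_vec (dim_col A) \<and> x \<bullet>c x = 1}"

definition hermitian_part :: "complex mat \<Rightarrow> complex mat" where
  "hermitian_part A = (1 / 2) \<cdot>\<^sub>m (A + mat_adjoint A)"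

definition skew_hermitian_part :: "complex mat \<Rightarrow> complex mat" where
  "skew_hermitian_part A = (1 / 2) \<cdot>\<^sub>m (A - mat_adjoint A)"

definition levinger :: "complex mat \<Rightarrow> real \<Rightarrow> real \<Rightarrow> complex mat" where
  "levinger A \<alpha> \<beta> =
     complex_of_real \<alpha> \<cdot>\<^sub>m hermitian_part A + complex_of_real \<beta> \<cdot>\<^sub>m skew_hermitian_part A"

text \<open>
  A polygon is understood here as a curve: the topological boundary in the plane of a
  convex polygonal region with \<open>k\<close> vertices. For \<open>k \<ge> 3\<close> the region has
  nonempty interior; the degenerate cases are a line segment (\<open>k = 2\<close>) and
  a single point (\<open>k = 1\<close>), each of which equals its own boundary.
\<close>

definition is_k_polygon :: "nat \<Rightarrow> complex set \<Rightarrow> bool" where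
  "is_k_polygon k P \<longleftrightarrow>
     (\<exists>S. polytope S \<and> card {v. v extreme_point_of S} = k \<and> P = frontier S)"

end

theory Submission
  imports Defs
begin

text \<open>
  For every vector \<open>x\<close> the number \<open>x\<^sup>* H\<^sub>A x\<close> is the real part of \<open>x\<^sup>* A x\<close> and \<open>x\<^sup>* S\<^sub>A x\<close> is \<open>\<i>\<close>
  times its imaginary part. Hence the Levinger transformation acts on each point \<open>z\<close> of the
  numerical range separately, by the real-linear map that stretches the real axis by \<open>\<alpha>\<close> and
  the imaginary axis by \<open>\<beta>\<close>: the numerical range of \<open>\<L>(A, \<alpha>, \<beta>)\<close> is the image of that of \<open>A\<close>
  under this map (\<open>numerical_range_levinger\<close>). Both parts of the theorem are statements about
  such images.

  Since \<open>\<alpha>\<close> and \<open>\<beta>\<close> are nonzero, the map is an automorphism of the real vector space \<open>\<complex>\<close>. It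
  therefore commutes with taking frontiers, and it carries polytopes to polytopes and extreme
  points bijectively to extreme points (\<open>is_k_polygon_image\<close>). This preserves the number of
  vertices.

  Since \<open>\<beta> \<noteq> 0\<close>, the map moves no point into or out of the real axis, and on the real axis it is
  multiplication by \<open>\<alpha>\<close>. Multiplication by \<open>\<alpha>\<close> is also how the numerical range of \<open>\<alpha> A\<close> arises
  from that of \<open>A\<close>, so the two ranges have the same real points.
\<close>

section \<open>The adjoint and the quadratic form\<close>

text \<open>
  The adjoint is the transpose of the entrywise conjugate, so the adjoint identity reduces to
  the bilinear one for the transpose.
\<close>

lemma mat_adjoint_cscalar_prod:
  fixes A :: "'a :: conjugatable_field mat"
  assumes A: "A \<in> carrier_mat nr nc" and x: "x \<in> carrier_vec nc" and y: "y \<in> carrier_vec nr"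
  shows "(mat_adjoint A *\<^sub>v y) \<bullet>c x = y \<bullet>c (A *\<^sub>v x)"
proof -
  let ?C = "map_mat conjugate A"
  have C: "?C \<in> carrier_mat nr nc"
    using A by simp
  have adj: "mat_adjoint A = transpose_mat ?C"
    by (rule eq_matI) (auto simp: mat_adjoint_def mat_of_rows_def)
  have conj: "?C *\<^sub>v conjugate x = conjugate (A *\<^sub>v x)"
  proof (rule eq_vecI)
    fix i assume "i < dim_vec (conjugate (A *\<^sub>v x))"
    then have i: "i < nr"
      using A by simp
    have "row ?C i = conjugate (row A i)"
      using A i by (intro eq_vecI) auto
    then show "(?C *\<^sub>v conjugate x) $ i = conjugate (A *\<^sub>v x) $ i"
      using A x i conjugate_sprod_vec[of "row A i" nc x] by simp
  qed (use A in simp)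
  show ?thesis
    using transpose_vec_mult_scalar[OF C carrier_vec_conjugate[OF x] y] adj conj by simp
qed

lemma mat_adjoint_quadratic_form:
  fixes A :: "complex mat"
  assumes A: "A \<in> carrier_mat n n" and x: "x \<in> carrier_vec n"
  shows "(mat_adjoint A *\<^sub>v x) \<bullet>c x = cnj ((A *\<^sub>v x) \<bullet>c x)"
proof -
  have Ax: "A *\<^sub>v x \<in> carrier_vec n"
    using A x by simp
  have "(mat_adjoint A *\<^sub>v x) \<bullet>c x = x \<bullet>c (A *\<^sub>v x)"
    by (rule mat_adjoint_cscalar_prod[OF A x x])
  also have "\<dots> = conjugate (A *\<^sub>v x) \<bullet> x"
    by (rule conjugate_vec_sprod_comm[OF x Ax])
  also have "\<dots> = cnj ((A *\<^sub>v x) \<bullet>c x)"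
    using conjugate_sprod_vec[OF Ax carrier_vec_conjugate[OF x]] by simp
  finally show ?thesis .
qed

lemma mat_adjoint_carrier:
  assumes "A \<in> carrier_mat nr nc"
  shows "mat_adjoint A \<in> carrier_mat nc nr"
  using assms by (auto simp: mat_adjoint_def)

lemma smult_mat_mult_vec:
  fixes A :: "'a :: comm_ring mat"
  assumes "A \<in> carrier_mat nr nc" and "x \<in> carrier_vec nc"
  shows "(c \<cdot>\<^sub>m A) *\<^sub>v x = c \<cdot>\<^sub>v (A *\<^sub>v x)"
  using assms by (intro eq_vecI) auto

section \<open>Numerical range of a Levinger transform\<close>

definition axis_scaling :: "real \<Rightarrow> real \<Rightarrow> complex \<Rightarrow> complex" where
  "axis_scaling \<alpha> \<beta> z = Complex (\<alpha> * Re z) (\<beta> * Im z)"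

lemma levinger_carrier:
  assumes "A \<in> carrier_mat n n"
  shows "levinger A \<alpha> \<beta> \<in> carrier_mat n n"
  using assms mat_adjoint_carrier[OF assms]
  by (auto simp: levinger_def hermitian_part_def skew_hermitian_part_def)

text \<open>
  With \<open>z = x\<^sup>* A x\<close> the adjoint contributes the conjugate of \<open>z\<close>, so the Hermitian and the
  skew-Hermitian part contribute \<open>(z + cnj z) / 2\<close> and \<open>(z - cnj z) / 2\<close>.
\<close>

lemma levinger_quadratic_form:
  assumes A: "A \<in> carrier_mat n n" and x: "x \<in> carrier_vec n"
  shows "(levinger A \<alpha> \<beta> *\<^sub>v x) \<bullet>c x = axis_scaling \<alpha> \<beta> ((A *\<^sub>v x) \<bullet>c x)"
proof -
  let ?B = "mat_adjoint A" and ?z = "(A *\<^sub>v x) \<bullet>c x"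
  note B = mat_adjoint_carrier[OF A]
  have Ax: "A *\<^sub>v x \<in> carrier_vec n" and Bx: "?B *\<^sub>v x \<in> carrier_vec n"
    and cx: "conjugate x \<in> carrier_vec n"
    using A B x by auto
  have H: "hermitian_part A \<in> carrier_mat n n" and S: "skew_hermitian_part A \<in> carrier_mat n n"
    using A B by (auto simp: hermitian_part_def skew_hermitian_part_def)
  have "hermitian_part A *\<^sub>v x = (1 / 2) \<cdot>\<^sub>v (A *\<^sub>v x + ?B *\<^sub>v x)"
    unfolding hermitian_part_def
    using smult_mat_mult_vec[of "A + ?B" n n x "1 / 2"] add_mult_distrib_mat_vec[OF A B x] A B x
    by simp
  then have Hx: "(hermitian_part A *\<^sub>v x) \<bullet>c x = (?z + cnj ?z) / 2"
    using smult_scalar_prod_distrib[OF add_carrier_vec[OF Ax Bx] cx]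
      add_scalar_prod_distrib[OF Ax Bx cx] mat_adjoint_quadratic_form[OF A x] by simp
  have "skew_hermitian_part A *\<^sub>v x = (1 / 2) \<cdot>\<^sub>v (A *\<^sub>v x - ?B *\<^sub>v x)"
    unfolding skew_hermitian_part_def
    using smult_mat_mult_vec[of "A - ?B" n n x "1 / 2"] minus_mult_distrib_mat_vec[OF A B x]
      minus_carrier_mat[OF B] x
    by simp
  then have Sx: "(skew_hermitian_part A *\<^sub>v x) \<bullet>c x = (?z - cnj ?z) / 2"
    using smult_scalar_prod_distrib[OF minus_carrier_vec[OF Ax Bx] cx]
      minus_scalar_prod_distrib[OF Ax Bx cx] mat_adjoint_quadratic_form[OF A x] by simp
  have "levinger A \<alpha> \<beta> *\<^sub>v x
      = complex_of_real \<alpha> \<cdot>\<^sub>v (hermitian_part A *\<^sub>v x)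
        + complex_of_real \<beta> \<cdot>\<^sub>v (skew_hermitian_part A *\<^sub>v x)"
    unfolding levinger_def
    using add_mult_distrib_mat_vec[of "complex_of_real \<alpha> \<cdot>\<^sub>m hermitian_part A" n n
        "complex_of_real \<beta> \<cdot>\<^sub>m skew_hermitian_part A" x]
      H S x smult_mat_mult_vec[OF H x] smult_mat_mult_vec[OF S x] by simp
  then have "(levinger A \<alpha> \<beta> *\<^sub>v x) \<bullet>c x
      = complex_of_real \<alpha> * ((hermitian_part A *\<^sub>v x) \<bullet>c x)
        + complex_of_real \<beta> * ((skew_hermitian_part A *\<^sub>v x) \<bullet>c x)"
    using H S x cx
      add_scalar_prod_distrib[of "complex_of_real \<alpha> \<cdot>\<^sub>v (hermitian_part A *\<^sub>v x)" n
        "complex_of_real \<beta> \<cdot>\<^sub>v (skew_hermitian_part A *\<^sub>v x)" "conjugate x"]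
    by simp
  also have "\<dots> = axis_scaling \<alpha> \<beta> ?z"
    unfolding Hx Sx by (simp add: complex_eq_iff axis_scaling_def)
  finally show ?thesis .
qed

lemma numerical_range_image:
  assumes "A \<in> carrier_mat m n"
  shows "numerical_range A = (\<lambda>x. (A *\<^sub>v x) \<bullet>c x) ` {x \<in> carrier_vec n. x \<bullet>c x = 1}"
  using assms by (simp only: numerical_range_def carrier_matD) blast

lemma numerical_range_levinger:
  assumes A: "A \<in> carrier_mat n n"
  shows "numerical_range (levinger A \<alpha> \<beta>) = axis_scaling \<alpha> \<beta> ` numerical_range A"
proof -
  have "numerical_range (levinger A \<alpha> \<beta>)
      = (\<lambda>x. (levinger A \<alpha> \<beta> *\<^sub>v x) \<bullet>c x) ` {x \<in> carrier_vec n. x \<bullet>c x = 1}"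
    by (rule numerical_range_image[OF levinger_carrier[OF A]])
  also have "\<dots> = (\<lambda>x. axis_scaling \<alpha> \<beta> ((A *\<^sub>v x) \<bullet>c x)) ` {x \<in> carrier_vec n. x \<bullet>c x = 1}"
    using levinger_quadratic_form[OF A] by (intro image_cong) auto
  finally show ?thesis
    by (simp only: numerical_range_image[OF A] image_image)
qed

lemma numerical_range_smult:
  assumes A: "A \<in> carrier_mat n n"
  shows "numerical_range (c \<cdot>\<^sub>m A) = (*) c ` numerical_range A"
proof -
  have "numerical_range (c \<cdot>\<^sub>m A)
      = (\<lambda>x. ((c \<cdot>\<^sub>m A) *\<^sub>v x) \<bullet>c x) ` {x \<in> carrier_vec n. x \<bullet>c x = 1}"
    by (rule numerical_range_image[OF smult_carrier_mat[OF A]])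
  also have "\<dots> = (\<lambda>x. c * ((A *\<^sub>v x) \<bullet>c x)) ` {x \<in> carrier_vec n. x \<bullet>c x = 1}"
    using A smult_mat_mult_vec[OF A] by (intro image_cong) auto
  finally show ?thesis
    by (simp only: numerical_range_image[OF A] image_image)
qed

section \<open>Polygons under linear automorphisms of the plane\<close>

lemma linear_axis_scaling: "linear (axis_scaling \<alpha> \<beta>)"
  by (rule linearI) (simp_all add: axis_scaling_def complex_eq_iff algebra_simps)

lemma inj_axis_scaling:
  assumes "\<alpha> \<noteq> 0" and "\<beta> \<noteq> 0"
  shows "inj (axis_scaling \<alpha> \<beta>)"
  using assms by (auto intro!: injI simp: axis_scaling_def complex_eq_iff)

lemma frontier_injective_linear_image:
  fixes f :: "'a :: euclidean_space \<Rightarrow> 'a"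
  assumes "linear f" and "inj f"
  shows "frontier (f ` S) = f ` frontier S"
  using assms
  by (simp add: frontier_def closure_injective_linear_image[symmetric]
      interior_injective_linear_image image_set_diff)

lemma extreme_points_linear_image:
  assumes "linear f" and "inj f"
  shows "{v. v extreme_point_of f ` S} = f ` {v. v extreme_point_of S}"
proof -
  have "f u extreme_point_of f ` S \<longleftrightarrow> u extreme_point_of S" for u
    using face_of_linear_image[OF assms, of "{u}" S] by (simp add: face_of_singleton)
  moreover have "v \<in> range f" if "v extreme_point_of f ` S" for v
    using that by (auto simp: extreme_point_of_def)
  ultimately show ?thesis
    by blast
qed

lemma is_k_polygon_image:
  assumes f: "linear f" "inj f" and P: "is_k_polygon k P"
  shows "is_k_polygon k (f ` P)"
proof -
  obtain S where S: "polytope S" "card {v. v extreme_point_of S} = k" "P = frontier S"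
    using P by (auto simp: is_k_polygon_def)
  have "polytope (f ` S)"
    by (rule polytope_linear_image[OF f(1) S(1)])
  moreover have "card {v. v extreme_point_of f ` S} = k"
    using S(2) f by (simp add: extreme_points_linear_image card_image inj_on_subset)
  moreover have "f ` P = frontier (f ` S)"
    using S(3) f by (simp add: frontier_injective_linear_image)
  ultimately show ?thesis
    unfolding is_k_polygon_def by blast
qed

section \<open>Invariance of polygons and of real points\<close>

text \<open>
  Only points that are already real have real image, and there both maps multiply by \<open>\<alpha>\<close>.
\<close>

lemma axis_scaling_image_Reals:
  assumes "\<alpha> \<noteq> 0" and "\<beta> \<noteq> 0"
  shows "axis_scaling \<alpha> \<beta> ` X \<inter> \<real> = \<real> \<inter> (*) (complex_of_real \<alpha>) ` X"
proof -
  have "axis_scaling \<alpha> \<beta> z \<in> \<real> \<longleftrightarrow> z \<in> \<real>" for z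
    using assms by (simp add: axis_scaling_def complex_is_Real_iff)
  then have "axis_scaling \<alpha> \<beta> ` X \<inter> \<real> = axis_scaling \<alpha> \<beta> ` (X \<inter> \<real>)"
    by blast
  moreover have "complex_of_real \<alpha> * z \<in> \<real> \<longleftrightarrow> z \<in> \<real>" for z
    using assms by (simp add: complex_is_Real_iff)
  then have "\<real> \<inter> (*) (complex_of_real \<alpha>) ` X = (*) (complex_of_real \<alpha>) ` (X \<inter> \<real>)"
    by blast
  moreover have "axis_scaling \<alpha> \<beta> ` (X \<inter> \<real>) = (*) (complex_of_real \<alpha>) ` (X \<inter> \<real>)"
    by (rule image_cong) (auto simp: axis_scaling_def complex_eq_iff complex_is_Real_iff)
  ultimately show ?thesis
    by simp
qed

theorem proposition3:
  fixes A :: "complex mat" and n :: nat and \<alpha> \<beta> :: real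
  assumes "A \<in> carrier_mat n n" and "\<alpha> \<noteq> 0" and "\<beta> \<noteq> 0"
  shows "(\<forall>k. normal_matrix A \<and> is_k_polygon k (frontier (numerical_range A)) \<longrightarrow>
            is_k_polygon k (frontier (numerical_range (levinger A \<alpha> \<beta>)))) \<and>
         numerical_range (levinger A \<alpha> \<beta>) \<inter> \<real> =
           \<real> \<inter> numerical_range (complex_of_real \<alpha> \<cdot>\<^sub>m A)"
proof -
  note f = linear_axis_scaling[of \<alpha> \<beta>] inj_axis_scaling[OF assms(2,3)]
  have "is_k_polygon k (frontier (numerical_range (levinger A \<alpha> \<beta>)))"
    if "is_k_polygon k (frontier (numerical_range A))" for k
    using is_k_polygon_image[OF f that]
    by (simp add: numerical_range_levinger[OF assms(1)] frontier_injective_linear_image[OF f])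
  moreover have "numerical_range (levinger A \<alpha> \<beta>) \<inter> \<real>
      = \<real> \<inter> numerical_range (complex_of_real \<alpha> \<cdot>\<^sub>m A)"
    using axis_scaling_image_Reals[OF assms(2,3)]
    by (simp add: numerical_range_levinger[OF assms(1)] numerical_range_smult[OF assms(1)])
  ultimately show ?thesis
    by blast
qed

end
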